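(* The set of all strong $P$ tensors is a proper subset of the set of all $P$ tensors; that is, for all positive integers $m,n$ every strong $P$ tensor in $T_{m,n}$ is a $P$ tensor, and there exist positive integers $m,n$ and a $P$ tensor in $T_{m,n}$ that is not a strong $P$ tensor.
   Context: Write $[n]=\{1,\dots,n\}$. $T_{m,n}$ denotes the set of all real $m$th order $n$-dimensional tensors $\mathcal{A}=(a_{i_1i_2\cdots i_m})$, $i_1,\dots,i_m\in[n]$ (no symmetry assumed). For $x\in\mathbb{R}^n$, $\mathcal{A}x^{m-1}\in\mathbb{R}^n$ is defined by $(\mathcal{A}x^{m-1})_i=\sum_{i_2,\dots,i_m=1}^n a_{ii_2\cdots i_m}x_{i_2}\cdots x_{i_m}$ for $i\in[n]$. $\mathcal{A}\in T_{m,n}$ is a $P$ tensor iff for each $x\in\mathbb{R}^n\setminus\{0\}$ there exists $i\in[n]$ such that $x_i(\mathcal{A}x^{m-1})_i>0$. A mapping $F:K\subseteq\mathbb{R}^n\to\mathbb{R}^n$ is a $P$-function if $\max_{i\in[n]}(x_i-y_i)(F_i(x)-F_i(y))>0$ for all pairs of distinct vectors $x,y\in K$. A tensor $\mathcal{A}\in T_{m,n}$ is a strong $P$ tensor iff $F(x)=\mathcal{A}x^{m-1}+q$ is a $P$-function on $\mathbb{R}^n$ (this condition does not depend on the choice of $q\in\mathbb{R}^n$). *)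

theory Defs
  imports "Jordan_Normal_Form.Matrix" "HOL-Library.FuncSet" "HOL-Library.NList"
begin

text \<open>
  Vectors in \<open>\<real>\<^sup>n\<close> are elements of \<^term>\<open>carrier_vec n :: real vec set\<close>, whose components are
  indexed by \<open>{0..<n}\<close>; the index set \<open>[n] = {1, \<dots>, n}\<close> is shifted accordingly.
  A tensor is a function on index tuples (lists), extensional so that equality of tensors is
  equality of entries.
\<close>

definition tensors :: "nat \<Rightarrow> nat \<Rightarrow> (nat list \<Rightarrow> real) set" where
  "tensors m n = nlists m {0..<n} \<rightarrow>\<^sub>E UNIV"

text \<open>\<open>tensor_app m n A x\<close> is \<open>A x\<^sup>m\<^sup>-\<^sup>1\<close>; the list \<open>js\<close> is \<open>(i\<^sub>2, \<dots>, i\<^sub>m)\<close>.\<close>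

definition tensor_app :: "nat \<Rightarrow> nat \<Rightarrow> (nat list \<Rightarrow> real) \<Rightarrow> real vec \<Rightarrow> real vec" where
  "tensor_app m n A x =
     vec n (\<lambda>i. \<Sum>js\<in>nlists (m - 1) {0..<n}. A (i # js) * (\<Prod>j\<leftarrow>js. x $ j))"

definition P_tensors :: "nat \<Rightarrow> nat \<Rightarrow> (nat list \<Rightarrow> real) set" where
  "P_tensors m n =
     {A \<in> tensors m n. \<forall>x\<in>carrier_vec n - {0\<^sub>v n}. \<exists>i\<in>{0..<n}. x $ i * tensor_app m n A x $ i > 0}"

definition P_function :: "nat \<Rightarrow> real vec set \<Rightarrow> (real vec \<Rightarrow> real vec) \<Rightarrow> bool" where
  "P_function n K F \<longleftrightarrow>
     K \<subseteq> carrier_vec n \<and> F \<in> K \<rightarrow> carrier_vec n \<and>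
     (\<forall>x\<in>K. \<forall>y\<in>K. x \<noteq> y \<longrightarrow>
        Max ((\<lambda>i. (x $ i - y $ i) * (F x $ i - F y $ i)) ` {0..<n}) > 0)"

definition strong_P_tensors :: "nat \<Rightarrow> nat \<Rightarrow> (nat list \<Rightarrow> real) set" where
  "strong_P_tensors m n =
     {A \<in> tensors m n.
        \<forall>q\<in>carrier_vec n. P_function n (carrier_vec n) (\<lambda>x. tensor_app m n A x + q)}"

text \<open>The choice of \<open>q\<close> is irrelevant.\<close>

lemma tensor_app_carrier [simp]: "tensor_app m n A x \<in> carrier_vec n"
  by (simp add: tensor_app_def)

lemma P_function_add_const:
  assumes F: "F \<in> K \<rightarrow> carrier_vec n" and q: "q \<in> carrier_vec n"
  shows "P_function n K (\<lambda>x. F x + q) \<longleftrightarrow> P_function n K F"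
proof -
  have "(\<lambda>i. (x $ i - y $ i) * ((F x + q) $ i - (F y + q) $ i)) ` {0..<n} =
        (\<lambda>i. (x $ i - y $ i) * (F x $ i - F y $ i)) ` {0..<n}" for x y
    using q by (intro image_cong) auto
  moreover have "(\<lambda>x. F x + q) \<in> K \<rightarrow> carrier_vec n"
    using F q by (intro funcsetI add_carrier_vec) (auto dest: funcset_mem)
  ultimately show ?thesis
    using F by (simp add: P_function_def)
qed

lemma strong_P_tensors_iff:
  assumes "q \<in> carrier_vec n"
  shows "A \<in> strong_P_tensors m n \<longleftrightarrow>
    A \<in> tensors m n \<and> P_function n (carrier_vec n) (\<lambda>x. tensor_app m n A x + q)"
proof -
  have "P_function n (carrier_vec n) (\<lambda>x. tensor_app m n A x + r) \<longleftrightarrow>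
        P_function n (carrier_vec n) (tensor_app m n A)" if "r \<in> carrier_vec n" for r
    using that by (intro P_function_add_const) auto
  then show ?thesis
    using assms by (auto simp: strong_P_tensors_def)
qed

end

theory Submission
  imports Defs
begin

text \<open>
  Comparing a point with the origin shows that a strong \<open>P\<close> tensor is a \<open>P\<close> tensor: for \<open>m \<ge> 2\<close>
  the map \<open>x \<mapsto> A x\<^sup>m\<^sup>-\<^sup>1\<close> vanishes at \<open>0\<close>, so the \<open>P\<close>-function inequality for the pair \<open>(x, 0)\<close>
  is the defining inequality of a \<open>P\<close> tensor. For \<open>m = 1\<close> the map is a constant that need not
  vanish at \<open>0\<close>, but a constant map is never a \<open>P\<close>-function on a nonzero space.

  The inclusion is strict because the \<open>P\<close> condition only sees pairs \<open>(x, 0)\<close> and therefore does not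
  force monotonicity along the coordinate axes. A map of the form \<open>F\<^sub>0(x) = x\<^sub>0 q(x)\<close>,
  \<open>F\<^sub>1(x) = x\<^sub>1\<^sup>3\<close> with a positive definite quadratic form \<open>q\<close> comes from a \<open>P\<close> tensor with
  \<open>m = 4\<close>, \<open>n = 2\<close>. With \<open>q = x\<^sub>0\<^sup>2 + b x\<^sub>0 x\<^sub>1 + c x\<^sub>1\<^sup>2\<close>, positive definiteness means
  \<open>b\<^sup>2 < 4 c\<close>, whereas \<open>F\<^sub>0\<close> fails to be increasing in \<open>x\<^sub>0\<close> at \<open>x\<^sub>1 = 1\<close> once \<open>b\<^sup>2 > 3 c\<close>.
  The choice \<open>b = -4\<close>, \<open>c = 5\<close> lies in this gap, and it makes the cubic
  \<open>t\<^sup>3 - 4 t\<^sup>2 + 5 t\<close> take the value \<open>2\<close> at both \<open>t = 1\<close> and \<open>t = 2\<close>. Hence \<open>F\<close> identifies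
  \<open>(1, 1)\<close> and \<open>(2, 1)\<close>, while a \<open>P\<close>-function is injective.
\<close>

lemma tensor_app_zero:
  assumes "m \<ge> 2"
  shows "tensor_app m n A (0\<^sub>v n) = 0\<^sub>v n"
proof -
  have "(\<Prod>j\<leftarrow>js. 0\<^sub>v n $ j) = (0 :: real)" if "js \<in> nlists (m - 1) {0..<n}" for js
    using that assms by (cases js) (auto dest: nlistsE_length)
  then have "(\<Sum>js\<in>nlists (m - 1) {0..<n}. A (i # js) * (\<Prod>j\<leftarrow>js. 0\<^sub>v n $ j)) = 0" for i
    by (intro sum.neutral) simp
  then show ?thesis
    by (auto simp: tensor_app_def)
qed

lemma tensor_app_order_one: "tensor_app 1 n A x = tensor_app 1 n A y"
  by (simp add: tensor_app_def)

lemma strong_P_tensor_iff_P_function: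
  "A \<in> strong_P_tensors m n \<longleftrightarrow>
     A \<in> tensors m n \<and> P_function n (carrier_vec n) (tensor_app m n A)"
proof -
  have "P_function n (carrier_vec n) (\<lambda>x. tensor_app m n A x + 0\<^sub>v n) \<longleftrightarrow>
      P_function n (carrier_vec n) (tensor_app m n A)"
    by (intro P_function_add_const) auto
  then show ?thesis
    using strong_P_tensors_iff[of "0\<^sub>v n" n A m] by (simp only: zero_carrier_vec simp_thms)
qed

text \<open>
  The dimension must be positive here, since the maximum over an empty index set is unspecified.
\<close>

lemma P_functionE:
  assumes "P_function n K F" "n > 0" "x \<in> K" "y \<in> K" "x \<noteq> y"
  obtains i where "i < n" "(x $ i - y $ i) * (F x $ i - F y $ i) > 0"
proof -
  let ?S = "(\<lambda>i. (x $ i - y $ i) * (F x $ i - F y $ i)) ` {0..<n}"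
  have "Max ?S > 0"
    using assms by (auto simp: P_function_def)
  moreover have "Max ?S \<in> ?S"
    using assms(2) by (intro Max_in) auto
  ultimately show ?thesis
    using that by auto
qed

lemma P_function_inj_on:
  assumes "P_function n K F" "n > 0"
  shows "inj_on F K"
proof (rule inj_onI, rule ccontr)
  fix x y
  assume xy: "x \<in> K" "y \<in> K" "F x = F y" "x \<noteq> y"
  obtain i where "(x $ i - y $ i) * (F x $ i - F y $ i) > 0"
    using P_functionE[OF assms xy(1,2,4)] .
  with xy(3) show False
    by simp
qed

lemma strong_P_tensors_subset_P_tensors:
  assumes "m \<ge> 1" "n \<ge> 1"
  shows "strong_P_tensors m n \<subseteq> P_tensors m n"
proof
  fix A
  assume "A \<in> strong_P_tensors m n"
  then have A: "A \<in> tensors m n" and P: "P_function n (carrier_vec n) (tensor_app m n A)"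
    by (auto simp: strong_P_tensor_iff_P_function)
  have "\<exists>i\<in>{0..<n}. x $ i * tensor_app m n A x $ i > 0"
    if x: "x \<in> carrier_vec n - {0\<^sub>v n}" for x
  proof (cases "m = 1")
    case True
    then have "tensor_app m n A x = tensor_app m n A (0\<^sub>v n)"
      by (simp only: tensor_app_order_one[of n A x "0\<^sub>v n"])
    moreover have "inj_on (tensor_app m n A) (carrier_vec n)"
      using P_function_inj_on[OF P] assms(2) by simp
    ultimately have "x = 0\<^sub>v n"
      using x by (elim inj_onD) simp_all
    with x show ?thesis
      by simp
  next
    case False
    with assms(1) have "tensor_app m n A (0\<^sub>v n) = 0\<^sub>v n"
      by (intro tensor_app_zero) simp
    moreover have "n > 0" "x \<in> carrier_vec n" "0\<^sub>v n \<in> carrier_vec n" "x \<noteq> 0\<^sub>v n"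
      using x assms(2) by auto
    then obtain i where "i < n"
      "(x $ i - 0\<^sub>v n $ i) * (tensor_app m n A x $ i - tensor_app m n A (0\<^sub>v n) $ i) > 0"
      by (rule P_functionE[OF P])
    ultimately show ?thesis
      by (intro bexI[of _ i]) auto
  qed
  with A show "A \<in> P_tensors m n"
    by (auto simp: P_tensors_def)
qed

text \<open>
  The tensor of the map \<open>F\<close> described above, which folds the line \<open>x\<^sub>1 = 1\<close> onto itself. As no
  symmetry is required, each monomial is carried by the single entry with nondecreasing indices.
\<close>

definition axis_fold_tensor :: "nat list \<Rightarrow> real" where
  "axis_fold_tensor = restrict
     (\<lambda>is. if is = [0, 0, 0, 0] \<or> is = [1, 1, 1, 1] then 1
           else if is = [0, 0, 0, 1] then -4
           else if is = [0, 0, 1, 1] then 5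
           else 0) (nlists 4 {0..<2})"

lemma axis_fold_tensor_in_tensors: "axis_fold_tensor \<in> tensors 4 2"
  by (simp add: axis_fold_tensor_def tensors_def)

lemma nlists_3_2:
  "nlists 3 {0..<2} =
     {[0,0,0], [0,0,1], [0,1,0], [0,1,1], [1,0,0], [1,0,1], [1,1,0], [1,1,1::nat]}"
proof -
  have "{0..<2} = {0, 1::nat}"
    by auto
  then show ?thesis
    by (simp add: numeral_3_eq_3 nlists_Suc insert_commute)
qed

lemma nlists_4_2:
  "i # js \<in> nlists 4 {0..<2} \<longleftrightarrow> i < 2 \<and> js \<in> nlists 3 {0..<2::nat}"
  using Cons_in_nlists_Suc[of i js 3 "{0..<2}"] by simp

lemma tensor_app_axis_fold_tensor:
  "tensor_app 4 2 axis_fold_tensor x $ 0 = x $ 0 * ((x $ 0 - 2 * x $ 1)\<^sup>2 + (x $ 1)\<^sup>2)"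
  "tensor_app 4 2 axis_fold_tensor x $ 1 = (x $ 1) ^ 3"
proof -
  have "tensor_app 4 2 axis_fold_tensor x $ 0 =
      (x $ 0) ^ 3 - 4 * (x $ 0)\<^sup>2 * x $ 1 + 5 * x $ 0 * (x $ 1)\<^sup>2"
    by (simp add: tensor_app_def nlists_3_2 axis_fold_tensor_def nlists_4_2
        power2_eq_square power3_eq_cube)
  also have "\<dots> = x $ 0 * ((x $ 0 - 2 * x $ 1)\<^sup>2 + (x $ 1)\<^sup>2)"
    by (simp add: power2_eq_square power3_eq_cube algebra_simps)
  finally show "tensor_app 4 2 axis_fold_tensor x $ 0 =
      x $ 0 * ((x $ 0 - 2 * x $ 1)\<^sup>2 + (x $ 1)\<^sup>2)" .
  show "tensor_app 4 2 axis_fold_tensor x $ 1 = (x $ 1) ^ 3"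
    by (simp add: tensor_app_def nlists_3_2 axis_fold_tensor_def nlists_4_2 power3_eq_cube)
qed

text \<open>
  Either coordinate can serve as the index required of a \<open>P\<close> tensor as soon as it is nonzero:
  the quadratic factor of the first component vanishes only at the origin.
\<close>

lemma axis_fold_tensor_P: "axis_fold_tensor \<in> P_tensors 4 2"
proof -
  have "\<exists>i\<in>{0..<2}. x $ i * tensor_app 4 2 axis_fold_tensor x $ i > 0"
    if x: "x \<in> carrier_vec 2 - {0\<^sub>v 2}" for x
  proof (cases "x $ 0 = 0")
    case True
    with x have "x $ 1 \<noteq> 0"
      by (auto simp: less_2_cases_iff)
    moreover have "x $ 1 * (x $ 1) ^ 3 = ((x $ 1)\<^sup>2)\<^sup>2"
      by (simp add: power2_eq_square power3_eq_cube)
    ultimately have "x $ 1 * tensor_app 4 2 axis_fold_tensor x $ 1 > 0"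
      unfolding tensor_app_axis_fold_tensor by simp
    then show ?thesis
      by (intro bexI[of _ 1]) auto
  next
    case False
    then have "(x $ 0 - 2 * x $ 1)\<^sup>2 + (x $ 1)\<^sup>2 > 0"
      by (auto simp: sum_power2_gt_zero_iff)
    with False have "(x $ 0)\<^sup>2 * ((x $ 0 - 2 * x $ 1)\<^sup>2 + (x $ 1)\<^sup>2) > 0"
      by (intro mult_pos_pos) simp_all
    then have "x $ 0 * tensor_app 4 2 axis_fold_tensor x $ 0 > 0"
      unfolding tensor_app_axis_fold_tensor by (simp add: power2_eq_square mult.assoc)
    then show ?thesis
      by (intro bexI[of _ 0]) auto
  qed
  with axis_fold_tensor_in_tensors show ?thesis
    by (auto simp: P_tensors_def)
qed

lemma axis_fold_tensor_not_strong_P: "axis_fold_tensor \<notin> strong_P_tensors 4 2"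
proof
  assume "axis_fold_tensor \<in> strong_P_tensors 4 2"
  then have inj: "inj_on (tensor_app 4 2 axis_fold_tensor) (carrier_vec 2)"
    by (intro P_function_inj_on[of 2]) (auto simp: strong_P_tensor_iff_P_function)
  define x y :: "real vec" where "x = vec 2 (\<lambda>_. 1)" and "y = vec 2 (\<lambda>i. if i = 0 then 2 else 1)"
  have xy: "x $ 0 = 1" "x $ 1 = 1" "y $ 0 = 2" "y $ 1 = 1"
    by (simp_all add: x_def y_def)
  have "tensor_app 4 2 axis_fold_tensor x = tensor_app 4 2 axis_fold_tensor y"
  proof (rule eq_vecI)
    fix i
    assume "i < dim_vec (tensor_app 4 2 axis_fold_tensor y)"
    then have "i = 0 \<or> i = 1"
      by (auto simp: tensor_app_def)
    then show "tensor_app 4 2 axis_fold_tensor x $ i = tensor_app 4 2 axis_fold_tensor y $ i"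
      using tensor_app_axis_fold_tensor[of x] tensor_app_axis_fold_tensor[of y]
      unfolding xy by auto
  qed (simp add: tensor_app_def)
  then have "x = y"
    by (rule inj_onD[OF inj]) (simp_all add: x_def y_def)
  then show False
    using xy by simp
qed

theorem mainTheorem4:
  shows "(\<forall>m n :: nat. m \<ge> 1 \<longrightarrow> n \<ge> 1 \<longrightarrow> strong_P_tensors m n \<subseteq> P_tensors m n) \<and>
         (\<exists>m n :: nat. m \<ge> 1 \<and> n \<ge> 1 \<and> (\<exists>A. A \<in> P_tensors m n \<and> A \<notin> strong_P_tensors m n))"
proof (intro conjI allI impI)
  fix m n :: nat
  assume "m \<ge> 1" "n \<ge> 1"
  then show "strong_P_tensors m n \<subseteq> P_tensors m n"
    by (rule strong_P_tensors_subset_P_tensors)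
next
  show "\<exists>m n :: nat. m \<ge> 1 \<and> n \<ge> 1 \<and> (\<exists>A. A \<in> P_tensors m n \<and> A \<notin> strong_P_tensors m n)"
    using axis_fold_tensor_P axis_fold_tensor_not_strong_P
    by (intro exI[of _ "4::nat"] exI[of _ "2::nat"]) auto
qed

end
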